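(* Let $f:\Pi\to\overline\Pi$ be an analytic function with Nevanlinna measure $\mu_f$. Then $f$ is $e^{-1/t}$-regular at $0$ if and only if the inverse moment problem for $\mu_f$ is analytically determined, i.e. the sequence of inverse moments $m_n=\int t^{-n}\,d\mu_f(t)$ satisfies $|m_n|<AB^n\,n!$ for some constants $A,B$.
   Context: $\Pi$ is the upper half plane in $\mathbb{C}$ and $\overline\Pi$ is its closure. The Nevanlinna measure $\mu_f$ of an analytic function $f:\Pi\to\overline\Pi$ is the weak limit, as $y\to0$, of the measures (in $x$) given by $\operatorname{Im} f(x+iy)$. For a monotone increasing function $\gamma:[0,\infty)\to\mathbb{R}^{\ge0}$ with $\gamma(t)=O(t^2)$ as $t\to0$, $f$ is called $\gamma$-regular at $\tau\in\mathbb{R}$ if there exists $C>0$ such that $\frac{1}{\gamma(C|t-\tau|)}$ is integrable on a neighborhood of $\tau$ with respect to $\mu_f$. Here $\gamma(t)=e^{-1/t}$ and $\tau=0$. A measure $\mu$ is called analytically determined if its sequence of moments $m_n$ satisfies $|m_n|<AB^n\,n!$; for the inverse (negative) moment problem the moments in question are $\int t^{-n}\,d\mu(t)$.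
   Formalization: The moment bound is required for all n ≥ 2, and for n = 0, 1 only if the integral of |t|^{-n} converges at infinity; otherwise the claim fails, e.g. for μ_f a multiple of Lebesgue measure on |t|>1, where f is regular at 0 but m_0 is infinite. *)

theory Defs
  imports "HOL-Analysis.Analysis" "HOL-Complex_Analysis.Complex_Analysis" "HOL-Library.Landau_Symbols"
begin

definition upper_half_plane :: "complex set" where
  "upper_half_plane = {z. Im z > 0}"

text \<open>
  The Nevanlinna measure as a relation: \<open>\<mu>\<close> is a Radon measure on the line and the limit, as
  \<open>y\<close> decreases to \<open>0\<close>, of the measures \<open>Im f(x + iy) dx\<close>. The test functions are continuous with
  compact support, because both these measures and their limit may have infinite mass
  (\<open>f = \<i>\<close> gives Lebesgue measure). There is no factor \<open>1/\<pi>\<close>.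
\<close>

definition is_nevanlinna_measure :: "(complex \<Rightarrow> complex) \<Rightarrow> real measure \<Rightarrow> bool" where
  "is_nevanlinna_measure f \<mu> \<longleftrightarrow>
     sets \<mu> = sets borel \<and>
     (\<forall>K. compact K \<longrightarrow> emeasure \<mu> K < \<infinity>) \<and>
     (\<forall>\<phi> :: real \<Rightarrow> real.
        continuous_on UNIV \<phi> \<and> compact (closure {x. \<phi> x \<noteq> 0}) \<longrightarrow>
        ((\<lambda>y. LINT x|lborel. \<phi> x * Im (f (Complex x y))) \<longlongrightarrow> (LINT x|\<mu>. \<phi> x)) (at_right 0))"

text \<open>Only the values of \<open>\<gamma>\<close> on \<open>[0, \<infinity>)\<close> matter.\<close>

definition regularity_gauge :: "(real \<Rightarrow> real) \<Rightarrow> bool" where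
  "regularity_gauge \<gamma> \<longleftrightarrow>
     mono_on {0..} \<gamma> \<and> (\<forall>t\<ge>0. \<gamma> t \<ge> 0) \<and> \<gamma> \<in> O[at_right 0](\<lambda>t. t\<^sup>2)"

text \<open>
  The reciprocal is taken in \<^typ>\<open>ennreal\<close>, so that it is \<open>\<infinity>\<close> wherever \<open>\<gamma>\<close> vanishes, in particular
  at \<open>t = \<tau>\<close>: regularity excludes an atom at \<open>\<tau>\<close>.
\<close>

definition gamma_regular :: "(real \<Rightarrow> real) \<Rightarrow> (complex \<Rightarrow> complex) \<Rightarrow> real \<Rightarrow> bool" where
  "gamma_regular \<gamma> f \<tau> \<longleftrightarrow>
     regularity_gauge \<gamma> \<and>
     (\<exists>\<mu>. is_nevanlinna_measure f \<mu> \<and>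
       (\<exists>C>0. \<exists>U. open U \<and> \<tau> \<in> U \<and>
          (\<integral>\<^sup>+t\<in>U. 1 / ennreal (\<gamma> (C * \<bar>t - \<tau>\<bar>)) \<partial>\<mu>) < \<infinity>))"

text \<open>The function \<open>exp (-1/t)\<close>, with its limit value at \<open>0\<close> (in HOL, \<open>exp (-1/0) = 1\<close>).\<close>

definition exp_gauge :: "real \<Rightarrow> real" where
  "exp_gauge t = (if t \<le> 0 then 0 else exp (- 1 / t))"

definition inverse_moment :: "real measure \<Rightarrow> nat \<Rightarrow> real" where
  "inverse_moment \<mu> n = (LINT t|\<mu>. 1 / t ^ n)"

text \<open>
  Absolute convergence of the integral defining the inverse moment. In \<^typ>\<open>ennreal\<close> the integrand
  is \<open>\<infinity>\<close> at \<open>t = 0\<close> if \<open>n > 0\<close>, so an atom at \<open>0\<close>, which the real-valued integral above does not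
  see, makes the moment infinite.
\<close>

definition inverse_moment_finite :: "real measure \<Rightarrow> nat \<Rightarrow> bool" where
  "inverse_moment_finite \<mu> n \<longleftrightarrow> (\<integral>\<^sup>+t. 1 / ennreal \<bar>t\<bar> ^ n \<partial>\<mu>) < \<infinity>"

definition inverse_moment_tail_finite :: "real measure \<Rightarrow> nat \<Rightarrow> bool" where
  "inverse_moment_tail_finite \<mu> n \<longleftrightarrow> (\<integral>\<^sup>+t\<in>{t. \<bar>t\<bar> \<ge> 1}. 1 / ennreal \<bar>t\<bar> ^ n \<partial>\<mu>) < \<infinity>"

text \<open>
  A Nevanlinna measure satisfies \<open>\<integral> 1/(1 + t\<^sup>2) d\<mu> < \<infinity>\<close> but can be infinite, so the moments with
  \<open>n < 2\<close> can diverge at infinity even if \<open>\<mu>\<close> vanishes near \<open>0\<close> (Lebesgue measure on \<open>\<bar>t\<bar> > 1\<close>).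
  Such a moment does not exist and is exempted from the bound; all others, in particular all
  moments of a finite measure, are required to exist and to obey it.
\<close>

definition inverse_analytically_determined :: "real measure \<Rightarrow> bool" where
  "inverse_analytically_determined \<mu> \<longleftrightarrow>
     (\<exists>A B :: real. \<forall>n. n \<ge> 2 \<or> inverse_moment_tail_finite \<mu> n \<longrightarrow>
        inverse_moment_finite \<mu> n \<and> \<bar>inverse_moment \<mu> n\<bar> < A * B ^ n * fact n)"

end

theory Submission
  imports Defs
begin

text \<open>
  Regularity asks for the integrability of \<open>exp (1 / (C * \<bar>t\<bar>))\<close> near \<open>0\<close>, whose power series is
  the sum of the terms \<open>1 / (C ^ n * fact n * \<bar>t\<bar> ^ n)\<close>. Bounding the exponential from below by a
  single term gives growth of the inverse moments of order \<open>B ^ n * fact n\<close> for the part of the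
  measure near \<open>0\<close> (\<open>inverse_moments_le_if_exp_gauge_integrable\<close>). Conversely, integrating the
  series term by term shows that such growth makes the exponential integrable once \<open>C\<close> is large
  (\<open>exp_gauge_integrable_if_determined\<close>). Here \<open>exp x \<le> 2 * cosh x\<close> reduces the series to even
  \<open>n\<close>, for which the moment equals the absolute moment.

  Two facts about Nevanlinna measures enter. Away from \<open>0\<close> the moments of order at least \<open>2\<close> are
  controlled by the integral of \<open>1 / (1 + t\<^sup>2)\<close>, which is at most \<open>pi * Im (f \<i>)\<close>
  (\<open>nevanlinna_measure_poisson_integral_le\<close>): this is the mean value property of \<open>Im f\<close>,
  carried from the disc to horizontal lines by the Cayley map and then to the weak limit. And the
  measure is unique (\<open>nevanlinna_measure_unique\<close>), so that regularity, which speaks of some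
  Nevanlinna measure of \<open>f\<close>, is a statement about the given one.
\<close>

section \<open>A Poisson estimate on a horizontal line\<close>

lemma circle_mean_Im:
  assumes "h holomorphic_on cball 0 r" "r > 0"
  shows "((\<lambda>t. Im (h (of_real r * cis t))) has_integral 2 * pi * Im (h 0)) {0..2 * pi}"
proof -
  have "((\<lambda>u. h u / (u - 0)) has_contour_integral 2 * of_real pi * \<i> * h 0) (circlepath 0 r)"
    by (rule Cauchy_integral_circlepath_simple) (use assms in auto)
  hence "((\<lambda>t. h (of_real r * cis t) / (of_real r * cis t) * of_real r * \<i> * cis t)
            has_integral 2 * of_real pi * \<i> * h 0) {0..2 * pi}"
    unfolding circlepath_def by (subst (asm) has_contour_integral_part_circlepath_iff) auto
  moreover have "h (of_real r * cis t) / (of_real r * cis t) * of_real r * \<i> * cis t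
      = \<i> * h (of_real r * cis t)" for t
    using assms(2) by (simp add: field_simps)
  ultimately have "((\<lambda>t. \<i> * h (of_real r * cis t)) has_integral 2 * of_real pi * \<i> * h 0) {0..2 * pi}"
    by (simp only:)
  from has_integral_linear[OF this bounded_linear_Re]
  have "((\<lambda>t. - Im (h (of_real r * cis t))) has_integral - (2 * pi * Im (h 0))) {0..2 * pi}"
    by (simp add: o_def)
  from has_integral_neg[OF this] show ?thesis by simp
qed

text \<open>
  The Cayley map of the unit disc onto the upper half plane, with \<open>0\<close> sent to \<open>\<i>\<close> and the
  boundary point \<open>1\<close> sent to infinity. At \<open>1\<close> the value is \<open>0\<close> by the convention for division.
\<close>
definition disc_to_half_plane :: "complex \<Rightarrow> complex" where
  "disc_to_half_plane w = \<i> * (1 + w) / (1 - w)"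

lemma Im_disc_to_half_plane: "Im (disc_to_half_plane w) = (1 - (norm w)\<^sup>2) / (norm (1 - w))\<^sup>2"
  unfolding disc_to_half_plane_def cmod_power2
  by (simp add: Im_divide power2_eq_square) (simp add: algebra_simps)

text \<open>
  The angle is measured from \<open>-1\<close>, the point that is sent to \<open>0\<close>, and halved; the boundary map is
  then the tangent.
\<close>
lemma disc_to_half_plane_cis:
  assumes "cos s \<noteq> 0"
  shows "disc_to_half_plane (cis (pi + 2 * s)) = of_real (tan s)"
proof -
  have w: "cis (pi + 2 * s) = - (cis s)\<^sup>2"
    by (simp add: Complex.DeMoivre complex_eq_iff)
  have sq: "1 = (cos s)\<^sup>2 + (sin s)\<^sup>2" by simp
  have 1: "1 + (cis s)\<^sup>2 = cis s * (2 * of_real (cos s))"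
    unfolding complex_eq_iff using sq by (simp add: power2_eq_square algebra_simps)
  have 2: "1 - (cis s)\<^sup>2 = - \<i> * cis s * (2 * of_real (sin s))"
    unfolding complex_eq_iff using sq by (simp add: power2_eq_square algebra_simps)
  show ?thesis
    unfolding disc_to_half_plane_def w using assms
    by (simp add: 1 2 tan_def field_simps)
qed

text \<open>
  Pulled back to the disc, \<open>Im F\<close> has mean value \<open>Im (F \<i>)\<close> on every circle of radius \<open>r < 1\<close>. As
  it is nonnegative, its integral over an arc that stays away from the point \<open>1\<close> is at most the
  whole integral, and on such an arc \<open>r\<close> may tend to \<open>1\<close>. The substitution by the tangent turns the
  limit arc into the interval \<open>{-X..X}\<close> with the Poisson kernel as weight.
\<close>
lemma poisson_partial_integral_le:
  fixes F :: "complex \<Rightarrow> complex"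
  assumes hol: "F holomorphic_on {z. Im z > - y}" and y: "y > 0"
    and pos: "\<And>z. Im z \<ge> 0 \<Longrightarrow> Im (F z) \<ge> 0" and X: "X > 0"
  shows "integral {-X..X} (\<lambda>x. Im (F (of_real x)) / (1 + x\<^sup>2)) \<le> pi * Im (F \<i>)"
proof -
  define a where "a = arctan X"
  have a: "0 < a" "a < pi / 2" "tan a = X"
    using X arctan_ubound[of X] by (auto simp: a_def tan_arctan)
  \<comment> \<open>The arc that \<open>disc_to_half_plane\<close> maps onto \<open>{-X..X}\<close>.\<close>
  define I where "I = {pi - 2 * a .. pi + 2 * a}"
  have I: "I \<subseteq> {0..2 * pi}" using a by (auto simp: I_def)
  have contF: "continuous_on {z. Im z > - y} F"
    using hol by (rule holomorphic_on_imp_continuous_on)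
  define u where "u = (\<lambda>r t. Im (F (disc_to_half_plane (of_real r * cis t))))"
  have ne1: "of_real r * cis t \<noteq> 1" if "r \<in> {0..1}" "t \<in> I" for r t
  proof
    assume eq: "of_real r * cis t = 1"
    hence "norm (of_real r * cis t) = 1" by simp
    hence "r = 1" using that by (simp add: norm_mult)
    hence "cos t = 1" using eq by (simp add: complex_eq_iff)
    then obtain x :: int where "t = of_int x * 2 * pi" by (auto simp: cos_one_2pi_int)
    moreover have "0 < t" "t < 2 * pi" using that a by (auto simp: I_def)
    ultimately have "0 < x" "x < 1" by (auto simp: zero_less_mult_iff)
    thus False by simp
  qed
  have mem: "Im (disc_to_half_plane (of_real r * cis t)) \<ge> 0" if "r \<in> {0..1}" for r t
    using that unfolding Im_disc_to_half_plane by (auto simp: norm_mult power_le_one)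
  have contu: "continuous_on ({0..1} \<times> I) (\<lambda>(r, t). u r t)"
    unfolding u_def split_def
  proof (rule continuous_on_Im, rule continuous_on_compose2[OF contF])
    show "continuous_on ({0..1} \<times> I) (\<lambda>p. disc_to_half_plane (of_real (fst p) * cis (snd p)))"
      unfolding disc_to_half_plane_def using ne1 by (intro continuous_intros) fastforce
    show "(\<lambda>p. disc_to_half_plane (of_real (fst p) * cis (snd p))) ` ({0..1} \<times> I) \<subseteq> {z. - y < Im z}"
      using mem y by (auto intro: less_le_trans[of "-y" 0])
  qed
  have contI: "continuous_on {0..1} (\<lambda>r. integral I (u r))"
    using integral_continuous_on_param[of "{0..1}" "pi - 2 * a" "pi + 2 * a" u] contu
    by (simp add: I_def)
  have le_r: "integral I (u r) \<le> 2 * pi * Im (F \<i>)" if r: "r \<in> {0<..<1}" for r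
  proof -
    have "((\<lambda>t. Im ((F \<circ> disc_to_half_plane) (of_real r * cis t)))
             has_integral 2 * pi * Im ((F \<circ> disc_to_half_plane) 0)) {0..2 * pi}"
    proof (rule circle_mean_Im)
      show "(F \<circ> disc_to_half_plane) holomorphic_on cball 0 r"
      proof (rule holomorphic_on_compose_gen[OF _ hol])
        show "disc_to_half_plane holomorphic_on cball 0 r"
          unfolding disc_to_half_plane_def using r by (intro holomorphic_intros) auto
        show "disc_to_half_plane ` cball 0 r \<subseteq> {z. - y < Im z}"
        proof safe
          fix w :: complex assume "w \<in> cball 0 r"
          hence "norm w \<le> 1" using r by auto
          hence "Im (disc_to_half_plane w) \<ge> 0"
            unfolding Im_disc_to_half_plane by (simp add: power_le_one)
          thus "- y < Im (disc_to_half_plane w)" using y by simp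
        qed
      qed
    qed (use r in auto)
    hence hi: "(u r has_integral 2 * pi * Im (F \<i>)) {0..2 * pi}"
      by (simp add: u_def o_def disc_to_half_plane_def)
    have "u r integrable_on I"
      using hi I unfolding I_def by (meson has_integral_integrable integrable_subinterval_real)
    hence "integral I (u r) \<le> integral {0..2 * pi} (u r)"
      using hi I r pos mem by (intro integral_subset_le) (auto simp: u_def has_integral_integrable)
    thus ?thesis using integral_unique[OF hi] by simp
  qed
  have le_1: "integral I (u 1) \<le> 2 * pi * Im (F \<i>)"
  proof (rule tendsto_upperbound)
    show "((\<lambda>r. integral I (u r)) \<longlongrightarrow> integral I (u 1)) (at 1 within {0..1})"
      using contI by (simp add: continuous_on_def)
    show "\<forall>\<^sub>F r in at 1 within {0..1}. integral I (u r) \<le> 2 * pi * Im (F \<i>)"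
      unfolding eventually_at using le_r by (intro exI[of _ 1]) (auto simp: dist_real_def)
    show "at (1::real) within {0..1} \<noteq> bot" by (simp add: trivial_limit_within islimpt_Icc)
  qed
  define v where "v = (\<lambda>x. Im (F (of_real x)) / (1 + x\<^sup>2))"
  have cosne: "cos ((t - pi) / 2) > 0" if "t \<in> I" for t
    using that a by (intro cos_gt_zero_pi) (auto simp: I_def)
  have "((\<lambda>t. ((1 + (tan ((t - pi) / 2))\<^sup>2) / 2) *\<^sub>R v (tan ((t - pi) / 2))) has_integral
          integral {tan ((pi - 2 * a - pi) / 2)..tan ((pi + 2 * a - pi) / 2)} v) {pi - 2 * a..pi + 2 * a}"
  proof (rule has_integral_substitution)
    show "tan ((pi - 2 * a - pi) / 2) \<le> tan ((pi + 2 * a - pi) / 2)" using a X by simp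
    show "(\<lambda>t. tan ((t - pi) / 2)) ` {pi - 2 * a..pi + 2 * a} \<subseteq> {-X..X}"
    proof safe
      fix t assume "t \<in> {pi - 2 * a..pi + 2 * a}"
      hence t: "- a \<le> (t - pi) / 2" "(t - pi) / 2 \<le> a" by auto
      have "tan (-a) \<le> tan ((t - pi) / 2)" "tan ((t - pi) / 2) \<le> tan a"
        using t a by (auto intro!: tan_mono_le simp del: tan_minus)
      thus "tan ((t - pi) / 2) \<in> {-X..X}" using a by simp
    qed
    show "continuous_on {-X..X} v"
      unfolding v_def
    proof (intro continuous_intros)
      show "continuous_on {-X..X} (\<lambda>x. F (of_real x))"
        by (rule continuous_on_compose2[OF contF]) (use y in \<open>auto intro!: continuous_intros\<close>)
      show "\<forall>x\<in>{- X..X}. 1 + x\<^sup>2 \<noteq> 0"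
        by (metis add_pos_nonneg less_numeral_extra(3) zero_le_power2 zero_less_one)
    qed
    show "((\<lambda>t. tan ((t - pi) / 2)) has_field_derivative (1 + (tan ((t - pi) / 2))\<^sup>2) / 2)
            (at t within {pi - 2 * a..pi + 2 * a})" if "t \<in> {pi - 2 * a..pi + 2 * a}" for t
    proof -
      have c: "cos ((t - pi) / 2) \<noteq> 0" using cosne[of t] that by (simp add: I_def)
      show ?thesis
        using c by (auto intro!: derivative_eq_intros simp: tan_sec power_inverse)
    qed
  qed (use a in auto)
  moreover have "((1 + (tan ((t - pi) / 2))\<^sup>2) / 2) *\<^sub>R v (tan ((t - pi) / 2)) = u 1 t / 2"
    if "t \<in> I" for t
  proof -
    have "1 + (tan ((t - pi) / 2))\<^sup>2 \<noteq> 0"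
      by (metis add_pos_nonneg less_numeral_extra(3) zero_le_power2 zero_less_one)
    moreover have "u 1 t = Im (F (of_real (tan ((t - pi) / 2))))"
      using disc_to_half_plane_cis[of "(t - pi) / 2"] cosne[OF that] by (simp add: u_def add_divide_distrib diff_divide_distrib)
    moreover have "c / 2 * (d / c) = d / 2" if "c \<noteq> 0" for c d :: real
      using that by simp
    ultimately show ?thesis by (simp only: v_def real_scaleR_def)
  qed
  ultimately have "((\<lambda>t. u 1 t / 2) has_integral integral {-X..X} v) I"
    using a unfolding I_def by (subst has_integral_cong[symmetric]) auto
  hence "integral {-X..X} v = integral I (u 1) / 2"
    by (auto dest!: integral_unique)
  thus ?thesis using le_1 by (simp add: v_def)
qed

section \<open>Uniqueness of the Nevanlinna measure\<close>

text \<open>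
  The continuous piecewise linear function that is \<open>1\<close> on \<open>{a..b}\<close> and falls to \<open>0\<close> with slope
  \<open>k\<close> on both sides. For \<open>k \<ge> 1\<close> its support lies in \<open>{a - 1..b + 1}\<close>.
\<close>
definition trapezoid :: "real \<Rightarrow> real \<Rightarrow> real \<Rightarrow> real \<Rightarrow> real" where
  "trapezoid a b k x = max 0 (1 - k * max 0 (max (a - x) (x - b)))"

lemma continuous_on_trapezoid [continuous_intros]: "continuous_on S (trapezoid a b k)"
  unfolding trapezoid_def by (intro continuous_intros)

lemma trapezoid_nonneg: "0 \<le> trapezoid a b k x"
  by (simp add: trapezoid_def)

lemma trapezoid_le_1: "k \<ge> 0 \<Longrightarrow> trapezoid a b k x \<le> 1"
  by (simp add: trapezoid_def)

lemma trapezoid_eq_1: "x \<in> {a..b} \<Longrightarrow> trapezoid a b k x = 1"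
  by (simp add: trapezoid_def)

lemma trapezoid_eq_0:
  assumes "k \<ge> 1" "x \<notin> {a - 1..b + 1}"
  shows "trapezoid a b k x = 0"
proof -
  have "1 \<le> max 0 (max (a - x) (x - b))" using assms(2) by auto
  hence "1 * 1 \<le> k * max 0 (max (a - x) (x - b))" using assms(1) by (intro mult_mono) auto
  thus ?thesis by (simp add: trapezoid_def)
qed

lemma trapezoid_le_indicator:
  "k \<ge> 1 \<Longrightarrow> trapezoid a b k x \<le> indicator {a - 1..b + 1} x"
  using trapezoid_le_1[of k a b x] trapezoid_eq_0[of k x a b] by (auto simp: indicator_def)

lemma trapezoid_tendsto_indicator:
  "(\<lambda>n. trapezoid a b (real (Suc n)) x) \<longlonglongrightarrow> indicator {a..b} x"
proof (cases "x \<in> {a..b}")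
  case True
  thus ?thesis by (simp add: trapezoid_eq_1)
next
  case False
  define d where "d = max 0 (max (a - x) (x - b))"
  have d: "d > 0" using False by (auto simp: d_def)
  have "\<forall>\<^sub>F n in sequentially. real n \<ge> 1 / d"
    by (rule eventually_ge_at_top[of "nat \<lceil>1/d\<rceil>", THEN eventually_mono]) linarith
  hence "\<forall>\<^sub>F n in sequentially. trapezoid a b (real (Suc n)) x = 0"
  proof eventually_elim
    case (elim n)
    have "1 \<le> real n * d" using elim d by (simp add: field_simps)
    also have "\<dots> \<le> real (Suc n) * d" using d by (intro mult_right_mono) auto
    finally show ?case by (simp add: trapezoid_def flip: d_def)
  qed
  thus ?thesis using False by (simp add: tendsto_eventually)
qed

lemma compact_support_if_subset_Icc:
  assumes "{x. g x \<noteq> 0} \<subseteq> {a..b :: real}"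
  shows "compact (closure {x. g x \<noteq> 0})"
  using assms bounded_subset[OF bounded_closed_interval] by auto

lemma tendsto_integral_trapezoid:
  assumes sets: "sets \<mu> = sets borel" and fin: "\<And>K. compact K \<Longrightarrow> emeasure \<mu> K < \<infinity>"
  shows "(\<lambda>n. LINT x|\<mu>. trapezoid a b (real (Suc n)) x) \<longlonglongrightarrow> measure \<mu> {a..b}"
proof -
  note [measurable_cong] = sets
  have "(\<lambda>n. LINT x|\<mu>. trapezoid a b (real (Suc n)) x) \<longlonglongrightarrow> (LINT x|\<mu>. indicator {a..b} x)"
  proof (rule integral_dominated_convergence)
    show "integrable \<mu> (indicator {a - 1..b + 1} :: real \<Rightarrow> real)"
      using fin[of "{a - 1..b + 1}"] by (simp add: sets)
    show "trapezoid a b (real (Suc n)) \<in> borel_measurable \<mu>" for n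
      using borel_measurable_continuous_onI[OF continuous_on_trapezoid] measurable_cong_sets[OF sets refl] by blast
    show "AE x in \<mu>. norm (trapezoid a b (real (Suc n)) x) \<le> indicator {a - 1..b + 1} x" for n
      using trapezoid_nonneg trapezoid_le_indicator by (intro AE_I2) simp
  qed (use trapezoid_tendsto_indicator sets in auto)
  thus ?thesis by (simp add: sets_eq_imp_space_eq[OF sets])
qed

text \<open>
  The trapezoids decrease to the indicators of compact intervals, which generate the Borel sets.
\<close>
lemma radon_measure_eqI:
  fixes \<mu> \<nu> :: "real measure"
  assumes sets: "sets \<mu> = sets borel" "sets \<nu> = sets borel"
    and fin: "\<And>K. compact K \<Longrightarrow> emeasure \<mu> K < \<infinity>" "\<And>K. compact K \<Longrightarrow> emeasure \<nu> K < \<infinity>"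
    and eq: "\<And>g :: real \<Rightarrow> real. continuous_on UNIV g \<Longrightarrow> compact (closure {x. g x \<noteq> 0})
               \<Longrightarrow> (LINT x|\<mu>. g x) = (LINT x|\<nu>. g x)"
  shows "\<mu> = \<nu>"
proof (rule measure_eqI_generator_eq)
  let ?E = "range (\<lambda>(a, b). {a..b :: real})"
  show "Int_stable ?E" by (auto simp: Int_stable_def)
  show "?E \<subseteq> Pow UNIV" by simp
  have "sets (borel :: real measure) = sigma_sets UNIV ?E"
    unfolding borel_eq_atLeastAtMost by (rule sets_measure_of) simp
  thus "sets \<mu> = sigma_sets UNIV ?E" "sets \<nu> = sigma_sets UNIV ?E"
    using sets by simp_all
  show "emeasure \<mu> S = emeasure \<nu> S" if "S \<in> ?E" for S
  proof -
    from that obtain a b where S: "S = {a..b}" by auto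
    have "(LINT x|\<mu>. trapezoid a b (real (Suc n)) x) = (LINT x|\<nu>. trapezoid a b (real (Suc n)) x)" for n
      using trapezoid_eq_0[of "real (Suc n)" _ a b]
      by (intro eq continuous_on_trapezoid compact_support_if_subset_Icc[of _ "a - 1" "b + 1"]) force
    moreover have "(\<lambda>n. LINT x|\<mu>. trapezoid a b (real (Suc n)) x) \<longlonglongrightarrow> measure \<mu> {a..b}"
      by (rule tendsto_integral_trapezoid[OF sets(1) fin(1)])
    moreover have "(\<lambda>n. LINT x|\<nu>. trapezoid a b (real (Suc n)) x) \<longlonglongrightarrow> measure \<nu> {a..b}"
      by (rule tendsto_integral_trapezoid[OF sets(2) fin(2)])
    ultimately have "measure \<mu> {a..b} = measure \<nu> {a..b}"
      by (simp only: LIMSEQ_unique)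
    moreover have "emeasure \<mu> {a..b} \<noteq> \<infinity>" "emeasure \<nu> {a..b} \<noteq> \<infinity>"
      using fin[of "{a..b}"] by auto
    ultimately show ?thesis by (simp add: S emeasure_eq_ennreal_measure)
  qed
  show "range (\<lambda>n. {- real n..real n}) \<subseteq> ?E" by auto
  show "(\<Union>n. {- real n..real n}) = UNIV"
  proof (intro equalityI subsetI)
    fix x :: real
    obtain n where "\<bar>x\<bar> \<le> real n" using real_arch_simple by blast
    thus "x \<in> (\<Union>n. {- real n..real n})" by (intro UN_I[of n]) auto
  qed simp
  show "emeasure \<mu> {- real n..real n} \<noteq> \<infinity>" for n
    using fin(1)[of "{- real n..real n}"] by simp
qed

lemma nevanlinna_measure_unique:
  assumes "is_nevanlinna_measure f \<mu>" "is_nevanlinna_measure f \<nu>"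
  shows "\<mu> = \<nu>"
proof (rule radon_measure_eqI)
  fix g :: "real \<Rightarrow> real"
  assume "continuous_on UNIV g" "compact (closure {x. g x \<noteq> 0})"
  hence "((\<lambda>y. LINT x|lborel. g x * Im (f (Complex x y))) \<longlongrightarrow> (LINT x|\<mu>. g x)) (at_right 0)"
    "((\<lambda>y. LINT x|lborel. g x * Im (f (Complex x y))) \<longlongrightarrow> (LINT x|\<nu>. g x)) (at_right 0)"
    using assms by (auto simp: is_nevanlinna_measure_def)
  thus "(LINT x|\<mu>. g x) = (LINT x|\<nu>. g x)"
    by (rule tendsto_unique[OF trivial_limit_at_right_real])
qed (use assms in \<open>auto simp: is_nevanlinna_measure_def\<close>)

section \<open>Poisson integrability of the Nevanlinna measure\<close>

lemma integral_truncated_poisson_le: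
  fixes f :: "complex \<Rightarrow> complex"
  assumes f: "f analytic_on upper_half_plane" and pos: "f ` upper_half_plane \<subseteq> closure upper_half_plane"
    and y: "y > 0" and N: "N \<ge> 0"
  shows "(LINT x|lborel. trapezoid (-N) N 1 x / (1 + x\<^sup>2) * Im (f (Complex x y)))
           \<le> pi * Im (f (\<i> + \<i> * of_real y))"
proof -
  define F where "F = (\<lambda>z. f (z + \<i> * of_real y))"
  define g where "g = (\<lambda>x. trapezoid (-N) N 1 x / (1 + x\<^sup>2) * Im (F (of_real x)))"
  define X where "X = N + 1"
  have hol_f: "f holomorphic_on {z. Im z > 0}"
    using analytic_imp_holomorphic[OF f] by (simp add: upper_half_plane_def)
  have hol: "F holomorphic_on {z. Im z > - y}"
    unfolding F_def by (rule holomorphic_on_compose_gen[OF _ hol_f, unfolded o_def])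
      (auto intro!: holomorphic_intros)
  have "closure upper_half_plane \<subseteq> {z. Im z \<ge> 0}"
    unfolding upper_half_plane_def by (rule closure_minimal) (auto simp: closed_halfspace_Im_ge)
  hence Im_f: "Im (f z) \<ge> 0" if "Im z > 0" for z
    using pos that by (auto simp: upper_half_plane_def)
  hence Im_F: "Im (F z) \<ge> 0" if "Im z \<ge> 0" for z
    using that y by (simp add: F_def)
  have cF: "continuous_on S (\<lambda>x. F (of_real x))" for S
    by (rule continuous_on_compose2[OF holomorphic_on_imp_continuous_on[OF hol]])
      (use y in \<open>auto intro!: continuous_intros\<close>)
  have nz: "1 + x\<^sup>2 \<noteq> 0" for x :: real
    by (metis add_pos_nonneg less_numeral_extra(3) zero_le_power2 zero_less_one)
  have cg: "continuous_on {-X..X} g"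
    unfolding g_def by (intro continuous_intros cF) (use nz in auto)
  have cv: "continuous_on {-X..X} (\<lambda>x. Im (F (of_real x)) / (1 + x\<^sup>2))"
    by (intro continuous_intros cF) (use nz in auto)
  have "(LINT x|lborel. trapezoid (-N) N 1 x / (1 + x\<^sup>2) * Im (f (Complex x y))) = (LINT x|lborel. g x)"
    by (simp add: g_def F_def complex_eq_cancel_iff2 Complex_eq)
  also have "\<dots> = (LINT x:{-X..X}|lborel. g x)"
    unfolding set_lebesgue_integral_def
  proof (rule Bochner_Integration.integral_cong)
    show "g x = indicator {-X..X} x *\<^sub>R g x" for x
      using trapezoid_eq_0[of 1 x "-N" N] by (auto simp: g_def X_def indicator_def)
  qed simp
  also have "\<dots> = integral {-X..X} g"
    by (rule set_borel_integral_eq_integral(2)[OF borel_integrable_atLeastAtMost'[OF cg]])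
  also have "\<dots> \<le> integral {-X..X} (\<lambda>x. Im (F (of_real x)) / (1 + x\<^sup>2))"
  proof (rule integral_le)
    show "g x \<le> Im (F (of_real x)) / (1 + x\<^sup>2)" for x
      using mult_right_mono[OF trapezoid_le_1[of 1 "-N" N x], of "Im (F (of_real x)) / (1 + x\<^sup>2)"]
        Im_F[of "of_real x"] by (simp add: g_def)
  qed (use cg cv in \<open>auto intro: integrable_continuous_real\<close>)
  also have "\<dots> \<le> pi * Im (F \<i>)"
    by (rule poisson_partial_integral_le[OF hol y Im_F]) (use N in \<open>auto simp: X_def\<close>)
  finally show ?thesis by (simp add: F_def)
qed

text \<open>
  The truncated Poisson kernels are test functions, so the estimate on the lines \<open>Im z = y\<close> passes
  to the limit measure; Fatou's lemma then removes the truncation.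
\<close>
lemma nevanlinna_measure_poisson_integral_le:
  assumes f: "f analytic_on upper_half_plane" "f ` upper_half_plane \<subseteq> closure upper_half_plane"
    and \<mu>: "is_nevanlinna_measure f \<mu>"
  shows "(\<integral>\<^sup>+t. ennreal (1 / (1 + t\<^sup>2)) \<partial>\<mu>) \<le> ennreal (pi * Im (f \<i>))"
proof -
  have sets: "sets \<mu> = sets borel" and fin: "\<And>K. compact K \<Longrightarrow> emeasure \<mu> K < \<infinity>"
    using \<mu> by (auto simp: is_nevanlinna_measure_def)
  note [measurable_cong] = sets
  have nz: "1 + x\<^sup>2 \<noteq> 0" "1 + x\<^sup>2 > 0" for x :: real
    by (metis add_pos_nonneg less_numeral_extra(3) zero_le_power2 zero_less_one)
       (simp add: add_pos_nonneg)
  define g where "g = (\<lambda>N x. trapezoid (- real N) (real N) 1 x / (1 + x\<^sup>2))"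
  have g0: "g N x \<ge> 0" for N x
    by (simp add: g_def trapezoid_nonneg)
  have cg: "continuous_on UNIV (g N)" for N
    unfolding g_def by (intro continuous_intros) (use nz in auto)
  have supp: "{x. g N x \<noteq> 0} \<subseteq> {- real N - 1..real N + 1}" for N
    using trapezoid_eq_0[of 1 _ "- real N" "real N"] by (force simp: g_def)
  have meas [measurable]: "g N \<in> borel_measurable \<mu>" for N
    using borel_measurable_continuous_onI[OF cg] measurable_cong_sets[OF sets refl] by blast
  have gle: "g N x \<le> indicator {- real N - 1..real N + 1} x" for N x
  proof -
    have "g N x \<le> trapezoid (- real N) (real N) 1 x / 1"
      unfolding g_def using trapezoid_nonneg nz by (intro divide_left_mono) auto
    thus ?thesis using trapezoid_le_indicator[of 1 "- real N" "real N" x] by simp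
  qed
  have int: "integrable \<mu> (g N)" for N
  proof (rule Bochner_Integration.integrable_bound)
    show "integrable \<mu> (indicator {- real N - 1..real N + 1} :: real \<Rightarrow> real)"
      using fin[of "{- real N - 1..real N + 1}"] by (simp add: sets)
    show "AE x in \<mu>. norm (g N x) \<le> norm (indicator {- real N - 1..real N + 1} x :: real)"
      using gle g0 by (intro AE_I2) simp
  qed measurable
  have le: "(LINT x|\<mu>. g N x) \<le> pi * Im (f \<i>)" for N
  proof (rule tendsto_le[OF trivial_limit_at_right_real])
    show "((\<lambda>y. LINT x|lborel. g N x * Im (f (Complex x y))) \<longlongrightarrow> (LINT x|\<mu>. g N x)) (at_right 0)"
      using \<mu> cg compact_support_if_subset_Icc[OF supp] unfolding is_nevanlinna_measure_def by blast
    have "isCont f \<i>"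
      using analytic_at_imp_isCont analytic_on_subset[OF f(1), of "{\<i>}"]
      by (auto simp: upper_half_plane_def)
    hence "isCont f (\<i> + \<i> * of_real 0)" by simp
    hence "isCont (\<lambda>y. f (\<i> + \<i> * of_real y)) (0 :: real)"
      by (rule isCont_o2[rotated]) (intro continuous_intros)
    hence "((\<lambda>y. f (\<i> + \<i> * of_real y)) \<longlongrightarrow> f \<i>) (at (0 :: real))"
      by (simp add: isCont_def)
    hence "((\<lambda>y. f (\<i> + \<i> * of_real y)) \<longlongrightarrow> f \<i>) (at_right (0 :: real))"
      by (rule tendsto_within_subset) simp
    thus "((\<lambda>y. pi * Im (f (\<i> + \<i> * of_real y))) \<longlongrightarrow> pi * Im (f \<i>)) (at_right (0 :: real))"
      by (intro tendsto_intros)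
    show "\<forall>\<^sub>F y in at_right 0. (LINT x|lborel. g N x * Im (f (Complex x y))) \<le> pi * Im (f (\<i> + \<i> * of_real y))"
      unfolding g_def
      by (rule eventually_at_right_less[THEN eventually_mono])
         (rule integral_truncated_poisson_le[OF f], auto)
  qed
  have "(\<integral>\<^sup>+t. ennreal (1 / (1 + t\<^sup>2)) \<partial>\<mu>) = (\<integral>\<^sup>+t. liminf (\<lambda>N. ennreal (g N t)) \<partial>\<mu>)"
  proof (rule nn_integral_cong)
    fix t
    have "\<forall>\<^sub>F N in sequentially. ennreal (1 / (1 + t\<^sup>2)) = ennreal (g N t)"
      using eventually_ge_at_top[of "nat \<lceil>\<bar>t\<bar>\<rceil>"]
    proof eventually_elim
      case (elim N)
      hence "t \<in> {- real N..real N}" by (auto simp: abs_le_iff)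
      thus ?case by (simp add: g_def trapezoid_eq_1)
    qed
    hence "(\<lambda>N. ennreal (g N t)) \<longlonglongrightarrow> ennreal (1 / (1 + t\<^sup>2))"
      by (intro tendsto_eventually) (auto elim: eventually_mono)
    thus "ennreal (1 / (1 + t\<^sup>2)) = liminf (\<lambda>N. ennreal (g N t))"
      by (intro lim_imp_Liminf[symmetric]) auto
  qed
  also have "\<dots> \<le> liminf (\<lambda>N. \<integral>\<^sup>+t. ennreal (g N t) \<partial>\<mu>)"
    by (rule nn_integral_liminf) measurable
  also have "\<dots> = liminf (\<lambda>N. ennreal (LINT t|\<mu>. g N t))"
    by (simp add: nn_integral_eq_integral[OF int] g0)
  also have "\<dots> \<le> liminf (\<lambda>N. ennreal (pi * Im (f \<i>)))"
    using le by (intro Liminf_mono always_eventually allI ennreal_leI)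
  also have "\<dots> = ennreal (pi * Im (f \<i>))" by (simp add: Liminf_const)
  finally show ?thesis .
qed

section \<open>Comparing the exponential with powers\<close>

lemma power_div_fact_le_exp:
  fixes x :: real
  assumes "x \<ge> 0"
  shows "x ^ n / fact n \<le> exp x"
proof -
  have "(\<lambda>k. x ^ k / fact k) sums exp x"
    using exp_converges[of x] by (simp add: scaleR_conv_of_real field_simps)
  hence "(\<Sum>k\<in>{n}. x ^ k / fact k) \<le> exp x"
    using assms by (metis (no_types, lifting) sum_le_suminf[of "\<lambda>k. x ^ k / fact k" "{n}"] sums_iff
        finite.intros divide_nonneg_nonneg zero_le_power fact_ge_zero)
  thus ?thesis by simp
qed

text \<open>
  This is \<open>exp x \<le> 2 * cosh x\<close>. Only even powers occur, and for even \<open>n\<close> the inverse moment is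
  the integral of a nonnegative function, so no odd moment has to be estimated. The constant term
  is kept apart because the moment of order \<open>0\<close> may be infinite.
\<close>
lemma exp_le_even_series:
  fixes x :: real
  shows "exp x \<le> 2 + (\<Sum>k. 2 * x ^ (2 * k + 2) / fact (2 * k + 2))"
    and "summable (\<lambda>k. 2 * x ^ (2 * k + 2) / fact (2 * k + 2))"
proof -
  define c where "c = (\<lambda>n. if even n then x ^ n /\<^sub>R fact n else 0)"
  have "c sums cosh x" unfolding c_def by (rule cosh_converges)
  hence "(\<lambda>k. c (2 * k)) sums cosh x"
    by (subst sums_mono_reindex[of "\<lambda>k. 2 * k"])
       (auto simp: strict_mono_def c_def elim!: evenE)
  hence "(\<lambda>k. c (2 * Suc k)) sums (cosh x - c (2 * 0))"
    by (subst sums_Suc_iff) simp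
  hence s: "(\<lambda>k. 2 * c (2 * Suc k)) sums (2 * (cosh x - c (2 * 0)))"
    by (rule sums_mult)
  have eq: "(\<lambda>k. 2 * c (2 * Suc k)) = (\<lambda>k. 2 * x ^ (2 * k + 2) / fact (2 * k + 2))"
    by (simp add: c_def field_simps fun_eq_iff)
  show "summable (\<lambda>k. 2 * x ^ (2 * k + 2) / fact (2 * k + 2))"
    using s unfolding eq by (rule sums_summable)
  have "exp x \<le> 2 * cosh x" by (simp add: cosh_def)
  also have "\<dots> = 2 + (\<Sum>k. 2 * x ^ (2 * k + 2) / fact (2 * k + 2))"
    using sums_unique[OF s] unfolding eq by (simp add: c_def)
  finally show "exp x \<le> 2 + (\<Sum>k. 2 * x ^ (2 * k + 2) / fact (2 * k + 2))" .
qed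

section \<open>The gauge \<open>exp (-1/t)\<close>\<close>

lemma exp_gauge_pos: "t > 0 \<Longrightarrow> exp_gauge t = exp (- 1 / t)" "t > 0 \<Longrightarrow> exp_gauge t > 0"
  by (auto simp: exp_gauge_def)

lemma exp_gauge_0 [simp]: "exp_gauge 0 = 0"
  by (simp add: exp_gauge_def)

lemma borel_measurable_exp_gauge [measurable]: "exp_gauge \<in> borel_measurable borel"
  unfolding exp_gauge_def by measurable

lemma regularity_gauge_exp_gauge: "regularity_gauge exp_gauge"
  unfolding regularity_gauge_def
proof (intro conjI allI impI)
  show "mono_on {0..} exp_gauge"
    by (auto simp: mono_on_def exp_gauge_def divide_left_mono_neg frac_le)
  show "exp_gauge t \<ge> 0" for t by (simp add: exp_gauge_def)
  show "exp_gauge \<in> O[at_right 0](\<lambda>t. t\<^sup>2)"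
  proof (rule bigoI)
    show "\<forall>\<^sub>F t in at_right 0. norm (exp_gauge t) \<le> 2 * norm (t\<^sup>2)"
      using eventually_at_right_less
    proof eventually_elim
      case (elim t)
      have "(1 / t)\<^sup>2 / fact 2 \<le> exp (1 / t)"
        using elim by (intro power_div_fact_le_exp) simp
      hence "exp (- (1 / t)) \<le> 2 * t\<^sup>2"
        using elim by (simp add: exp_minus field_simps power2_eq_square)
      thus ?case using elim by (simp add: exp_gauge_def)
    qed
  qed
qed

lemma inverse_exp_gauge:
  assumes "C > 0" "t \<noteq> 0"
  shows "1 / ennreal (exp_gauge (C * \<bar>t\<bar>)) = ennreal (exp (1 / (C * \<bar>t\<bar>)))"
  using assms by (simp add: exp_gauge_pos divide_ennreal exp_minus flip: ennreal_1 del: ennreal_eq_1)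
   (simp add: field_simps)

lemma inverse_ennreal_power:
  assumes "t \<noteq> 0"
  shows "1 / ennreal \<bar>t\<bar> ^ n = ennreal (1 / \<bar>t\<bar> ^ n)"
  using assms by (simp add: ennreal_power divide_ennreal flip: ennreal_1 del: ennreal_eq_1)

text \<open>At \<open>t = 0\<close> the right-hand side is \<open>\<infinity>\<close>, so no hypothesis on \<open>t\<close> is needed.\<close>
lemma inverse_power_le_exp_gauge:
  assumes C: "C > 0"
  shows "1 / ennreal \<bar>t\<bar> ^ n \<le> ennreal (C ^ n * fact n) * (1 / ennreal (exp_gauge (C * \<bar>t\<bar>)))"
proof (cases "t = 0")
  case True
  thus ?thesis using C by (simp add: ennreal_mult_top)
next
  case False
  have "(1 / (C * \<bar>t\<bar>)) ^ n / fact n \<le> exp (1 / (C * \<bar>t\<bar>))"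
    using C by (intro power_div_fact_le_exp) simp
  hence "1 / \<bar>t\<bar> ^ n \<le> C ^ n * fact n * exp (1 / (C * \<bar>t\<bar>))"
    using C False by (simp add: field_simps)
  thus ?thesis using C False
    by (simp add: inverse_exp_gauge inverse_ennreal_power ennreal_mult'' [symmetric] ennreal_leI)
qed

text \<open>
  At \<open>t = 0\<close> both sides are \<open>\<infinity>\<close>. The summands start at the order \<open>2\<close>, the first one whose
  moment is bound to exist.
\<close>
lemma inverse_exp_gauge_le_even_series:
  assumes C: "C > 0"
  shows "1 / ennreal (exp_gauge (C * \<bar>t\<bar>))
    \<le> 2 + (\<Sum>k. ennreal (2 / (C ^ (2 * k + 2) * fact (2 * k + 2))) * (1 / ennreal \<bar>t\<bar> ^ (2 * k + 2)))"
    (is "_ \<le> 2 + suminf ?s")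
proof (cases "t = 0")
  case True
  hence "?s 0 = \<infinity>" using C by (simp add: ennreal_mult_top)
  moreover have "(\<Sum>k\<in>{0}. ?s k) \<le> suminf ?s" by (rule sum_le_suminf) auto
  ultimately show ?thesis by (simp add: top_unique)
next
  case False
  define x where "x = 1 / (C * \<bar>t\<bar>)"
  have nonneg: "0 \<le> 2 * x ^ (2 * k + 2) / fact (2 * k + 2)" for k
    using C by (simp add: x_def)
  have eq: "?s k = ennreal (2 * x ^ (2 * k + 2) / fact (2 * k + 2))" for k
    using C False unfolding inverse_ennreal_power[OF False]
    by (subst ennreal_mult'' [symmetric]) (auto simp: x_def power_mult_distrib power_divide field_simps)
  have "1 / ennreal (exp_gauge (C * \<bar>t\<bar>)) = ennreal (exp x)"
    using C False by (simp add: inverse_exp_gauge x_def)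
  also have "\<dots> \<le> ennreal (2 + (\<Sum>k. 2 * x ^ (2 * k + 2) / fact (2 * k + 2)))"
    by (intro ennreal_leI exp_le_even_series)
  also have "\<dots> = 2 + ennreal (\<Sum>k. 2 * x ^ (2 * k + 2) / fact (2 * k + 2))"
    using suminf_nonneg[OF exp_le_even_series(2) nonneg] by (subst ennreal_plus) simp_all
  also have "ennreal (\<Sum>k. 2 * x ^ (2 * k + 2) / fact (2 * k + 2)) = suminf ?s"
    unfolding eq by (rule suminf_ennreal2[OF nonneg exp_le_even_series(2), symmetric])
  finally show ?thesis .
qed

section \<open>Inverse moments\<close>

lemma abs_inverse_moment_le:
  assumes "sets \<mu> = sets borel"
  shows "ennreal \<bar>inverse_moment \<mu> n\<bar> \<le> (\<integral>\<^sup>+t. 1 / ennreal \<bar>t\<bar> ^ n \<partial>\<mu>)"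
proof (cases "integrable \<mu> (\<lambda>t. 1 / t ^ n)")
  case True
  have "ennreal \<bar>inverse_moment \<mu> n\<bar> \<le> (\<integral>\<^sup>+t. ennreal \<bar>1 / t ^ n\<bar> \<partial>\<mu>)"
    using integral_norm_bound_ennreal[OF True] by (simp add: inverse_moment_def)
  also have "\<dots> \<le> (\<integral>\<^sup>+t. 1 / ennreal \<bar>t\<bar> ^ n \<partial>\<mu>)"
  proof (rule nn_integral_mono)
    fix t :: real
    show "ennreal \<bar>1 / t ^ n\<bar> \<le> 1 / ennreal \<bar>t\<bar> ^ n"
      by (cases "t = 0"; cases "n = 0") (simp_all add: inverse_ennreal_power power_abs zero_power)
  qed
  finally show ?thesis .
qed (simp add: inverse_moment_def not_integrable_integral_eq)

text \<open>
  Finiteness of the left-hand side rules out an atom at \<open>0\<close>, which is where the two integrands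
  differ.
\<close>
lemma even_inverse_moment_eq:
  assumes sets: "sets \<mu> = sets borel" and fin: "inverse_moment_finite \<mu> n" and n: "even n" "n > 0"
  shows "(\<integral>\<^sup>+t. 1 / ennreal \<bar>t\<bar> ^ n \<partial>\<mu>) = ennreal (inverse_moment \<mu> n)"
proof -
  note [measurable_cong] = sets
  have "AE t in \<mu>. 1 / ennreal \<bar>t\<bar> ^ n \<noteq> \<infinity>"
    using fin unfolding inverse_moment_finite_def by (intro nn_integral_PInf_AE) auto
  hence AE: "AE t in \<mu>. 1 / ennreal \<bar>t\<bar> ^ n = ennreal (1 / t ^ n)"
  proof (rule AE_mp, intro AE_I2 impI)
    fix t :: real assume "1 / ennreal \<bar>t\<bar> ^ n \<noteq> \<infinity>"
    hence "t \<noteq> 0" using n by (cases "t = 0") (auto simp: zero_power)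
    thus "1 / ennreal \<bar>t\<bar> ^ n = ennreal (1 / t ^ n)"
      using n by (simp add: inverse_ennreal_power power_even_abs)
  qed
  have eq: "(\<integral>\<^sup>+t. 1 / ennreal \<bar>t\<bar> ^ n \<partial>\<mu>) = (\<integral>\<^sup>+t. ennreal (1 / t ^ n) \<partial>\<mu>)"
    by (rule nn_integral_cong_AE[OF AE])
  have "integrable \<mu> (\<lambda>t. 1 / t ^ n)"
    using fin n unfolding inverse_moment_finite_def eq
    by (intro integrableI_nonneg) (auto simp: zero_le_even_power)
  thus ?thesis
    unfolding eq inverse_moment_def using n
    by (intro nn_integral_eq_integral) (auto simp: zero_le_even_power)
qed

section \<open>Regularity bounds the inverse moments\<close>

text \<open>
  Near \<open>0\<close> the factorial growth comes from \<open>x ^ n / fact n \<le> exp x\<close> at \<open>x = 1 / (C * \<bar>t\<bar>)\<close>.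
  Away from \<open>0\<close>, say for \<open>\<bar>t\<bar> \<ge> d\<close>, the growth is only geometric, because
  \<open>\<bar>t\<bar> ^ (- n)\<close> is at most \<open>(1/d) ^ n * (d\<^sup>2 + 1)\<close> times the Poisson kernel \<open>1 / (1 + t\<^sup>2)\<close>.
\<close>
lemma inverse_moments_le_if_exp_gauge_integrable:
  assumes sets: "sets \<mu> = sets borel"
    and poisson: "(\<integral>\<^sup>+t. ennreal (1 / (1 + t\<^sup>2)) \<partial>\<mu>) < \<infinity>"
    and C: "C > 0" and U: "open U" "0 \<in> U"
    and reg: "(\<integral>\<^sup>+t\<in>U. 1 / ennreal (exp_gauge (C * \<bar>t\<bar>)) \<partial>\<mu>) < \<infinity>"
  obtains K B where "K \<ge> 0" "B \<ge> 0"
    "\<And>n. n \<ge> 2 \<Longrightarrow> (\<integral>\<^sup>+t. 1 / ennreal \<bar>t\<bar> ^ n \<partial>\<mu>) \<le> ennreal (K * B ^ n * fact n)"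
proof -
  note [measurable_cong] = sets
  have [measurable]: "U \<in> sets borel" using U by auto
  obtain d where d: "d > 0" "ball 0 d \<subseteq> U" using U by (meson open_contains_ball)
  define M where "M = enn2real (\<integral>\<^sup>+t\<in>U. 1 / ennreal (exp_gauge (C * \<bar>t\<bar>)) \<partial>\<mu>)"
  define P where "P = enn2real (\<integral>\<^sup>+t. ennreal (1 / (1 + t\<^sup>2)) \<partial>\<mu>)"
  have M: "(\<integral>\<^sup>+t\<in>U. 1 / ennreal (exp_gauge (C * \<bar>t\<bar>)) \<partial>\<mu>) = ennreal M" "M \<ge> 0"
    using reg by (auto simp: M_def)
  have P: "(\<integral>\<^sup>+t. ennreal (1 / (1 + t\<^sup>2)) \<partial>\<mu>) = ennreal P" "P \<ge> 0"
    using poisson by (auto simp: P_def)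
  define a where "a = (\<lambda>n. C ^ n * fact n :: real)"
  define b where "b = (\<lambda>n. (1 / d) ^ n * (d\<^sup>2 + 1))"
  have ab: "a n \<ge> 0" "b n \<ge> 0" for n using C d by (auto simp: a_def b_def)
  have pointwise: "1 / ennreal \<bar>t\<bar> ^ n
      \<le> ennreal (a n) * (1 / ennreal (exp_gauge (C * \<bar>t\<bar>)) * indicator U t)
        + ennreal (b n) * ennreal (1 / (1 + t\<^sup>2))" if n: "n \<ge> 2" for n t
  proof (cases "\<bar>t\<bar> < d")
    case True
    hence "t \<in> U" using d by auto
    thus ?thesis using inverse_power_le_exp_gauge[OF C, of t n]
      by (intro add_increasing2) (auto simp: a_def)
  next
    case False
    obtain m where m: "n = m + 2" using n by (metis add.commute le_Suc_ex)
    have t: "t \<noteq> 0" "d \<le> \<bar>t\<bar>" using False d by auto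
    have "d\<^sup>2 \<le> t\<^sup>2" using t d abs_le_square_iff[of d t] by auto
    hence "1 / t\<^sup>2 \<le> (1 + 1 / d\<^sup>2) * (1 / (1 + t\<^sup>2))"
      using t d by (simp add: field_simps add_pos_nonneg)
    moreover have "(1 / \<bar>t\<bar>) ^ m \<le> (1 / d) ^ m"
      using t d by (intro power_mono) (auto simp: field_simps)
    ultimately have "(1 / \<bar>t\<bar>) ^ m * (1 / t\<^sup>2) \<le> (1 / d) ^ m * ((1 + 1 / d\<^sup>2) * (1 / (1 + t\<^sup>2)))"
      using d by (intro mult_mono) auto
    moreover have "(1 / \<bar>t\<bar>) ^ m * (1 / t\<^sup>2) = 1 / \<bar>t\<bar> ^ n"
      by (simp add: m power_divide power_add power2_eq_square)
    moreover have "(1 / d) ^ m * (1 + 1 / d\<^sup>2) = b n"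
      using d by (simp add: m b_def power_divide power_add field_simps power2_eq_square)
    ultimately have "1 / \<bar>t\<bar> ^ n \<le> b n * (1 / (1 + t\<^sup>2))"
      by (simp only: mult.assoc [symmetric])
    hence "1 / ennreal \<bar>t\<bar> ^ n \<le> ennreal (b n) * ennreal (1 / (1 + t\<^sup>2))"
      unfolding inverse_ennreal_power[OF t(1)] using ab
      by (simp add: ennreal_leI flip: ennreal_mult'')
    thus ?thesis by (rule add_increasing[OF zero_le])
  qed
  show ?thesis
  proof (rule that[of "M + (d\<^sup>2 + 1) * P" "C + 1 / d"])
    fix n :: nat assume n: "n \<ge> 2"
    have "(\<integral>\<^sup>+t. 1 / ennreal \<bar>t\<bar> ^ n \<partial>\<mu>)
        \<le> (\<integral>\<^sup>+t. ennreal (a n) * (1 / ennreal (exp_gauge (C * \<bar>t\<bar>)) * indicator U t)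
              + ennreal (b n) * ennreal (1 / (1 + t\<^sup>2)) \<partial>\<mu>)"
      by (intro nn_integral_mono pointwise n)
    also have "\<dots> = ennreal (a n) * ennreal M + ennreal (b n) * ennreal P"
      by (subst nn_integral_add, measurable, measurable)
         (simp add: nn_integral_cmult M P)
    also have "\<dots> = ennreal (a n * M + b n * P)"
      using ab M P by (simp add: ennreal_mult'' ennreal_plus)
    also have "\<dots> \<le> ennreal ((M + (d\<^sup>2 + 1) * P) * (C + 1 / d) ^ n * fact n)"
    proof (rule ennreal_leI)
      have "C ^ n \<le> (C + 1 / d) ^ n" "(1 / d) ^ n \<le> (C + 1 / d) ^ n"
        using C d by (auto intro!: power_mono)
      moreover have "(1 / d) ^ n * 1 \<le> (C + 1 / d) ^ n * fact n"
        using C d by (intro mult_mono calculation) auto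
      ultimately have "C ^ n * fact n * M \<le> (C + 1 / d) ^ n * fact n * M"
        "(1 / d) ^ n * 1 * ((d\<^sup>2 + 1) * P) \<le> (C + 1 / d) ^ n * fact n * ((d\<^sup>2 + 1) * P)"
        using M P by (auto intro!: mult_right_mono simp del: mult_1_right)
      thus "a n * M + b n * P \<le> (M + (d\<^sup>2 + 1) * P) * (C + 1 / d) ^ n * fact n"
        by (simp add: a_def b_def algebra_simps)
    qed
    finally show "(\<integral>\<^sup>+t. 1 / ennreal \<bar>t\<bar> ^ n \<partial>\<mu>) \<le> ennreal ((M + (d\<^sup>2 + 1) * P) * (C + 1 / d) ^ n * fact n)" .
  qed (use M P C d in auto)
qed

text \<open>Inside the unit interval a higher inverse power dominates a lower one.\<close>
lemma inverse_moment_finite_if_tail_finite: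
  assumes sets: "sets \<mu> = sets borel" and n: "n \<le> m"
    and fin: "inverse_moment_finite \<mu> m" "inverse_moment_tail_finite \<mu> n"
  shows "inverse_moment_finite \<mu> n"
proof -
  note [measurable_cong] = sets
  have "(\<integral>\<^sup>+t. 1 / ennreal \<bar>t\<bar> ^ n \<partial>\<mu>)
      \<le> (\<integral>\<^sup>+t. 1 / ennreal \<bar>t\<bar> ^ m + 1 / ennreal \<bar>t\<bar> ^ n * indicator {t. \<bar>t\<bar> \<ge> 1} t \<partial>\<mu>)"
  proof (rule nn_integral_mono)
    fix t :: real
    show "1 / ennreal \<bar>t\<bar> ^ n \<le> 1 / ennreal \<bar>t\<bar> ^ m + 1 / ennreal \<bar>t\<bar> ^ n * indicator {t. \<bar>t\<bar> \<ge> 1} t"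
    proof (cases "\<bar>t\<bar> \<ge> 1")
      case False
      have "1 / ennreal \<bar>t\<bar> ^ n \<le> 1 / ennreal \<bar>t\<bar> ^ m"
      proof (cases "t = 0")
        case True
        thus ?thesis using n by (cases "m = 0") (auto simp: zero_power)
      next
        case t: False
        have "1 / \<bar>t\<bar> ^ n \<le> 1 / \<bar>t\<bar> ^ m"
          using False t n by (intro divide_left_mono power_decreasing) auto
        thus ?thesis by (simp add: inverse_ennreal_power[OF t] ennreal_leI)
      qed
      thus ?thesis by (rule add_increasing2[OF zero_le])
    qed (auto intro: add_increasing)
  qed
  also have "\<dots> = (\<integral>\<^sup>+t. 1 / ennreal \<bar>t\<bar> ^ m \<partial>\<mu>)
      + (\<integral>\<^sup>+t\<in>{t. \<bar>t\<bar> \<ge> 1}. 1 / ennreal \<bar>t\<bar> ^ n \<partial>\<mu>)"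
    by (rule nn_integral_add) measurable
  also have "\<dots> < \<infinity>"
    using fin by (simp add: inverse_moment_finite_def inverse_moment_tail_finite_def)
  finally show ?thesis by (simp add: inverse_moment_finite_def)
qed

lemma inverse_analytically_determinedI:
  assumes sets: "sets \<mu> = sets borel" and KB: "K \<ge> 0" "B \<ge> 0"
    and le: "\<And>n. n \<ge> 2 \<Longrightarrow> (\<integral>\<^sup>+t. 1 / ennreal \<bar>t\<bar> ^ n \<partial>\<mu>) \<le> ennreal (K * B ^ n * fact n)"
  shows "inverse_analytically_determined \<mu>"
proof -
  \<comment> \<open>The two moments of order below \<open>2\<close> are absorbed into the constant, and \<open>B + 1 \<ge> 1\<close> keeps
    the geometric factor from spoiling this.\<close>
  define A where "A = K + (\<bar>inverse_moment \<mu> 0\<bar> + \<bar>inverse_moment \<mu> 1\<bar>) + 1"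
  have fin2: "inverse_moment_finite \<mu> n" if "n \<ge> 2" for n
    using le[OF that] unfolding inverse_moment_finite_def by (simp add: le_less_trans)
  have "inverse_moment_finite \<mu> n \<and> \<bar>inverse_moment \<mu> n\<bar> < A * (B + 1) ^ n * fact n"
    if n: "n \<ge> 2 \<or> inverse_moment_tail_finite \<mu> n" for n
  proof
    show "inverse_moment_finite \<mu> n"
      using n fin2 inverse_moment_finite_if_tail_finite[OF sets, of n 2] by (cases "n \<ge> 2") auto
    have A: "A > K" "A > 0" using KB by (auto simp: A_def)
    have B: "1 \<le> (B + 1) ^ n" "B ^ n \<le> (B + 1) ^ n"
      using KB by (auto intro!: power_mono one_le_power)
    show "\<bar>inverse_moment \<mu> n\<bar> < A * (B + 1) ^ n * fact n"
    proof (cases "n \<ge> 2")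
      case True
      have "ennreal \<bar>inverse_moment \<mu> n\<bar> \<le> ennreal (K * B ^ n * fact n)"
        by (rule order.trans[OF abs_inverse_moment_le[OF sets] le[OF True]])
      hence "\<bar>inverse_moment \<mu> n\<bar> \<le> K * B ^ n * fact n"
        using KB by (subst (asm) ennreal_le_iff) auto
      also have "\<dots> \<le> K * (B + 1) ^ n * fact n"
        using KB B by (intro mult_right_mono mult_left_mono) auto
      also have "\<dots> < A * (B + 1) ^ n * fact n"
        using A B by (intro mult_strict_right_mono) auto
      finally show ?thesis .
    next
      case False
      hence "n = 0 \<or> n = 1" by auto
      hence "\<bar>inverse_moment \<mu> n\<bar> < A * 1 * 1" using KB by (auto simp: A_def)
      also have "\<dots> \<le> A * (B + 1) ^ n * fact n"
        using A B by (intro mult_mono) auto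
      finally show ?thesis .
    qed
  qed
  thus ?thesis unfolding inverse_analytically_determined_def by blast
qed

section \<open>Moment bounds imply regularity\<close>

lemma exp_gauge_integrable_if_determined:
  assumes sets: "sets \<mu> = sets borel" and fin: "\<And>K. compact K \<Longrightarrow> emeasure \<mu> K < \<infinity>"
    and det: "inverse_analytically_determined \<mu>"
  obtains C where "C > 0" "(\<integral>\<^sup>+t\<in>{-1<..<1}. 1 / ennreal (exp_gauge (C * \<bar>t\<bar>)) \<partial>\<mu>) < \<infinity>"
proof -
  note [measurable_cong] = sets
  from det obtain A B where AB: "\<And>n. n \<ge> 2 \<Longrightarrow>
      inverse_moment_finite \<mu> n \<and> \<bar>inverse_moment \<mu> n\<bar> < A * B ^ n * fact n"
    unfolding inverse_analytically_determined_def by blast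
  \<comment> \<open>With \<open>\<bar>B\<bar> / C \<le> 1 / 2\<close> the factorials cancel and the series of moments becomes geometric.\<close>
  define C where "C = 2 * (\<bar>B\<bar> + 1)"
  have C: "C > 0" by (simp add: C_def)
  let ?J = "\<lambda>n. \<integral>\<^sup>+t. 1 / ennreal \<bar>t\<bar> ^ n \<partial>\<mu>"
  let ?c = "\<lambda>k. 2 / (C ^ (2 * k + 2) * fact (2 * k + 2))"
  have term_le: "ennreal (?c k) * ?J (2 * k + 2) \<le> ennreal (2 * \<bar>A\<bar> * (1 / 2) ^ k)" for k
  proof -
    define n where "n = 2 * k + 2"
    have n: "n \<ge> 2" "even n" "n > 0" by (auto simp: n_def)
    have "inverse_moment \<mu> n \<le> \<bar>A * B ^ n * fact n\<bar>"
      using AB[OF n(1)] by linarith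
    also have "\<dots> = \<bar>A\<bar> * \<bar>B\<bar> ^ n * fact n" by (simp add: abs_mult power_abs)
    finally have "inverse_moment \<mu> n \<le> \<bar>A\<bar> * \<bar>B\<bar> ^ n * fact n" .
    hence "2 / (C ^ n * fact n) * inverse_moment \<mu> n \<le> 2 / (C ^ n * fact n) * (\<bar>A\<bar> * \<bar>B\<bar> ^ n * fact n)"
      using C by (intro mult_left_mono) auto
    also have "\<dots> = 2 * \<bar>A\<bar> * (\<bar>B\<bar> / C) ^ n" using C by (simp add: power_divide)
    also have "\<dots> \<le> 2 * \<bar>A\<bar> * (1 / 2) ^ n"
      using C by (intro mult_left_mono power_mono) (auto simp: C_def field_simps)
    also have "\<dots> \<le> 2 * \<bar>A\<bar> * (1 / 2) ^ k"
      by (intro mult_left_mono power_decreasing) (auto simp: n_def)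
    finally have "ennreal (2 / (C ^ n * fact n) * inverse_moment \<mu> n) \<le> ennreal (2 * \<bar>A\<bar> * (1 / 2) ^ k)"
      by (rule ennreal_leI)
    moreover have "?J n = ennreal (inverse_moment \<mu> n)"
      using AB[OF n(1)] n by (intro even_inverse_moment_eq sets) auto
    moreover have "0 \<le> 2 / (C ^ n * fact n)" using C by simp
    ultimately show ?thesis unfolding n_def [symmetric] by (simp only: ennreal_mult')
  qed
  have "(\<integral>\<^sup>+t\<in>{-1<..<1}. 1 / ennreal (exp_gauge (C * \<bar>t\<bar>)) \<partial>\<mu>)
      \<le> (\<integral>\<^sup>+t. 2 * indicator {-1..1} t + (\<Sum>k. ennreal (?c k) * (1 / ennreal \<bar>t\<bar> ^ (2 * k + 2))) \<partial>\<mu>)"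
    using inverse_exp_gauge_le_even_series[OF C]
    by (intro nn_integral_mono) (auto simp: indicator_def)
  also have "\<dots> = 2 * emeasure \<mu> {-1..1} + (\<Sum>k. ennreal (?c k) * ?J (2 * k + 2))"
    by (subst nn_integral_add, measurable, measurable)
       (simp add: nn_integral_suminf nn_integral_cmult sets)
  also have "\<dots> \<le> 2 * emeasure \<mu> {-1..1} + (\<Sum>k. ennreal (2 * \<bar>A\<bar> * (1 / 2) ^ k))"
    by (intro add_left_mono suminf_le term_le) auto
  also have "(\<Sum>k. ennreal (2 * \<bar>A\<bar> * (1 / 2) ^ k)) = ennreal (\<Sum>k. 2 * \<bar>A\<bar> * (1 / 2) ^ k)"
    by (intro suminf_ennreal2 summable_mult summable_geometric) auto
  also have "2 * emeasure \<mu> {-1..1} + \<dots> < \<infinity>"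
    using fin[of "{-1..1}"] by (simp add: ennreal_mult_less_top)
  finally show ?thesis using that[OF C] by blast
qed

section \<open>The characterisation\<close>

theorem theorem2p5:
  fixes f :: "complex \<Rightarrow> complex" and \<mu> :: "real measure"
  assumes "f analytic_on upper_half_plane"
    and "f ` upper_half_plane \<subseteq> closure upper_half_plane"
    and "is_nevanlinna_measure f \<mu>"
  shows "gamma_regular exp_gauge f 0 \<longleftrightarrow> inverse_analytically_determined \<mu>"
proof
  have sets: "sets \<mu> = sets borel" and fin: "\<And>K. compact K \<Longrightarrow> emeasure \<mu> K < \<infinity>"
    using assms(3) by (auto simp: is_nevanlinna_measure_def)
  {
    assume "gamma_regular exp_gauge f 0"
    then obtain \<nu> C U where \<nu>: "is_nevanlinna_measure f \<nu>" and C: "C > 0" and U: "open U" "0 \<in> U"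
      and reg: "(\<integral>\<^sup>+t\<in>U. 1 / ennreal (exp_gauge (C * \<bar>t\<bar>)) \<partial>\<nu>) < \<infinity>"
      unfolding gamma_regular_def by auto
    have "\<nu> = \<mu>" by (rule nevanlinna_measure_unique[OF \<nu> assms(3)])
    have "(\<integral>\<^sup>+t. ennreal (1 / (1 + t\<^sup>2)) \<partial>\<mu>) < \<infinity>"
      using nevanlinna_measure_poisson_integral_le[OF assms] by (simp add: le_less_trans)
    then obtain K B where "K \<ge> 0" "B \<ge> 0"
      "\<And>n. n \<ge> 2 \<Longrightarrow> (\<integral>\<^sup>+t. 1 / ennreal \<bar>t\<bar> ^ n \<partial>\<mu>) \<le> ennreal (K * B ^ n * fact n)"
      using inverse_moments_le_if_exp_gauge_integrable[OF sets _ C U] reg unfolding \<open>\<nu> = \<mu>\<close> by metis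
    thus "inverse_analytically_determined \<mu>"
      by (rule inverse_analytically_determinedI[OF sets])
  }
  {
    assume "inverse_analytically_determined \<mu>"
    then obtain C where "C > 0"
      "(\<integral>\<^sup>+t\<in>{-1<..<1}. 1 / ennreal (exp_gauge (C * \<bar>t\<bar>)) \<partial>\<mu>) < \<infinity>"
      using exp_gauge_integrable_if_determined[OF sets fin] by blast
    thus "gamma_regular exp_gauge f 0"
      unfolding gamma_regular_def
      using regularity_gauge_exp_gauge assms(3)
      by (intro conjI exI[of _ \<mu>] exI[of _ C] exI[of _ "{-1<..<1}"]) auto
  }
qed

end
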